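(* Consider a network with fixed (deterministic) parameters $\boldsymbol{W}_\ell\in\mathbb{R}^{N_{\ell-1}\times N_\ell}$, $\boldsymbol{b}^{(\ell)}\in\mathbb{R}^{N_\ell}$, $\ell=1,\dots,L$, where the input and output of each layer are related via $$\boldsymbol{x}^{(\ell)}=\mathrm{ReLU}\big(\boldsymbol{W}_\ell^\top\boldsymbol{x}^{(\ell-1)}+\boldsymbol{b}^{(\ell)}\big),\qquad \ell=1,\dots,L.$$ If the network is fed with i.i.d. sample vectors $\boldsymbol{x}^{(0)}_1,\dots,\boldsymbol{x}^{(0)}_P\sim\mathcal{N}(\boldsymbol{0},\boldsymbol{I})$ in $\mathbb{R}^{N_0}$, then for every $\ell=1,\dots,L$ the corresponding response samples $\boldsymbol{x}^{(\ell)}_1,\dots,\boldsymbol{x}^{(\ell)}_P$ at the output of layer $\ell$ are i.i.d. subgaussian random vectors.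
   Context: $\mathrm{ReLU}$ acts entrywise as $x\mapsto\max(x,0)$. A real random variable $\varphi$ is subgaussian if there exists a constant $\kappa$ such that $\mathbb{P}\{|\varphi|>t\}\le\exp(1-t^2/\kappa^2)$ for all $t\ge0$ (equivalently, there is a constant $\hat\kappa$ with $\mathbb{E}\exp(\varphi^2/\hat\kappa^2)\le e$). A random vector $\boldsymbol{\varphi}\in\mathbb{R}^N$ is subgaussian if for all $\boldsymbol{\alpha}\in\mathbb{R}^N$ (equivalently, all unit $\boldsymbol{\alpha}$) the marginal $\boldsymbol{\alpha}^\top\boldsymbol{\varphi}$ is subgaussian. *)

theory Defs
  imports "HOL-Probability.Probability"
begin

text \<open>
  The dimensions vary from layer to layer, so a vector in $\mathbb{R}^n$ is an extensional
  function on \<open>{..<n}\<close>, i.e. a point of the finite product space below.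
\<close>

abbreviation borel_vec :: "nat \<Rightarrow> (nat \<Rightarrow> real) measure" where
  "borel_vec n \<equiv> (\<Pi>\<^sub>M i\<in>{..<n}. borel)"

definition iid :: "'a measure \<Rightarrow> 'b measure \<Rightarrow> ('i \<Rightarrow> 'a \<Rightarrow> 'b) \<Rightarrow> 'i set \<Rightarrow> bool" where
  "iid M S X I \<longleftrightarrow> prob_space.indep_vars M (\<lambda>_. S) X I \<and>
     (\<forall>p\<in>I. \<forall>q\<in>I. distr M S (X p) = distr M S (X q))"

definition std_normal_vec :: "nat \<Rightarrow> (nat \<Rightarrow> real) measure" where
  "std_normal_vec n = density (\<Pi>\<^sub>M i\<in>{..<n}. lborel)
     (\<lambda>x. ennreal ((2 * pi) powr (- real n / 2) * exp (- (\<Sum>i<n. (x i)\<^sup>2) / 2)))"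

definition relu :: "real \<Rightarrow> real" where
  "relu x = max x 0"

text \<open>
  \<open>layer m n W b\<close> maps $x \in \mathbb{R}^m$ to
  $\mathrm{ReLU}(W^\top x + b) \in \mathbb{R}^n$, where \<open>W i j\<close> is the entry in row
  \<open>i < m\<close> and column \<open>j < n\<close>.
\<close>

definition layer ::
  "nat \<Rightarrow> nat \<Rightarrow> (nat \<Rightarrow> nat \<Rightarrow> real) \<Rightarrow> (nat \<Rightarrow> real) \<Rightarrow> (nat \<Rightarrow> real) \<Rightarrow> (nat \<Rightarrow> real)" where
  "layer m n W b x = (\<lambda>j\<in>{..<n}. relu ((\<Sum>i<m. W i j * x i) + b j))"

text \<open>
  The condition \<open>\<kappa> > 0\<close> is essential: since \<open>t\<^sup>2 / 0 = 0\<close>, the choice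
  \<open>\<kappa> = 0\<close> would make the tail bound hold for every random variable.
\<close>

definition subgaussian :: "'a measure \<Rightarrow> ('a \<Rightarrow> real) \<Rightarrow> bool" where
  "subgaussian M \<phi> \<longleftrightarrow> \<phi> \<in> borel_measurable M \<and>
     (\<exists>\<kappa>>0. \<forall>t\<ge>0. measure M {\<omega> \<in> space M. \<bar>\<phi> \<omega>\<bar> > t} \<le> exp (1 - t\<^sup>2 / \<kappa>\<^sup>2))"

definition subgaussian_vec :: "'a measure \<Rightarrow> nat \<Rightarrow> ('a \<Rightarrow> nat \<Rightarrow> real) \<Rightarrow> bool" where
  "subgaussian_vec M n \<phi> \<longleftrightarrow> \<phi> \<in> measurable M (borel_vec n) \<and>
     (\<forall>\<alpha> :: nat \<Rightarrow> real. subgaussian M (\<lambda>\<omega>. \<Sum>i<n. \<alpha> i * \<phi> \<omega> i))"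

lemma std_normal_vec_density_eq:
  "(2 * pi) powr (- real n / 2) * exp (- (\<Sum>i<n. (x i)\<^sup>2) / 2) = (\<Prod>i<n. std_normal_density (x i))"
proof -
  have "(2 * pi) powr (- real n / 2) = (1 / sqrt (2 * pi)) ^ n"
  proof -
    have "(1 / sqrt (2 * pi)) = (2 * pi) powr (- 1 / 2)"
      by (simp add: powr_minus_divide powr_half_sqrt)
    then show ?thesis
      by (simp add: powr_power)
  qed
  moreover have "exp (- (\<Sum>i<n. (x i)\<^sup>2) / 2) = (\<Prod>i<n. exp (- (x i)\<^sup>2 / 2))"
    by (simp add: exp_sum[symmetric] sum_negf sum_divide_distrib)
  ultimately show ?thesis
    by (simp add: std_normal_density_def prod.distrib prod_dividef power_divide)
qed

lemma std_normal_vec_eq_PiM: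
  "std_normal_vec n = (\<Pi>\<^sub>M i\<in>{..<n}. density lborel std_normal_density)"
proof (rule product_sigma_finite.PiM_eqI)
  interpret product_sigma_finite "\<lambda>_::nat. lborel :: real measure" ..
  interpret prob_space "density lborel std_normal_density"
    by (rule prob_space_normal_density) simp
  show "product_sigma_finite (\<lambda>_::nat. density lborel std_normal_density)"
    by (simp add: product_sigma_finite_def sigma_finite_measure_axioms)
  show "sets (std_normal_vec n) = sets (\<Pi>\<^sub>M i\<in>{..<n}. density lborel std_normal_density)"
    by (simp add: std_normal_vec_def cong: sets_PiM_cong)
  fix A :: "nat \<Rightarrow> real set"
  assume A: "\<And>i. i \<in> {..<n} \<Longrightarrow> A i \<in> sets (density lborel std_normal_density)"
  have [measurable]: "Pi\<^sub>E {..<n} A \<in> sets (\<Pi>\<^sub>M i\<in>{..<n}. lborel)"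
    using A by (intro sets_PiM_I_finite) auto
  have "emeasure (std_normal_vec n) (Pi\<^sub>E {..<n} A) =
      (\<integral>\<^sup>+x. ennreal (\<Prod>i<n. std_normal_density (x i)) * indicator (Pi\<^sub>E {..<n} A) x
        \<partial>(\<Pi>\<^sub>M i\<in>{..<n}. lborel))"
    unfolding std_normal_vec_def std_normal_vec_density_eq
    by (rule emeasure_density) measurable
  also have "\<dots> = (\<integral>\<^sup>+x. (\<Prod>i<n. ennreal (std_normal_density (x i)) * indicator (A i) (x i))
        \<partial>(\<Pi>\<^sub>M i\<in>{..<n}. lborel))"
  proof (rule nn_integral_cong)
    fix x :: "nat \<Rightarrow> real" assume "x \<in> space (\<Pi>\<^sub>M i\<in>{..<n}. lborel)"
    then have "indicator (Pi\<^sub>E {..<n} A) x = (\<Prod>i<n. indicator (A i) (x i) :: ennreal)"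
      by (auto simp: indicator_def space_PiM PiE_iff split: if_splits)
    then show "ennreal (\<Prod>i<n. std_normal_density (x i)) * indicator (Pi\<^sub>E {..<n} A) x =
        (\<Prod>i<n. ennreal (std_normal_density (x i)) * indicator (A i) (x i))"
      by (simp add: prod.distrib prod_ennreal)
  qed
  also have "\<dots> = (\<Prod>i<n. \<integral>\<^sup>+x. ennreal (std_normal_density x) * indicator (A i) x \<partial>lborel)"
    using A by (intro product_nn_integral_prod) auto
  also have "\<dots> = (\<Prod>i<n. emeasure (density lborel std_normal_density) (A i))"
    using A by (intro prod.cong refl emeasure_density[symmetric]) auto
  finally show "emeasure (std_normal_vec n) (Pi\<^sub>E {..<n} A) =
      (\<Prod>i<n. emeasure (density lborel std_normal_density) (A i))" .
qed auto

end

theory Submission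
  imports Defs
begin

text \<open>
  Tail bounds of the required form are stable under domination, scaling, sums (split the level
  \<open>t\<close> in halves and use a union bound) and hold for constants. Hence every layer preserves
  subgaussianity coordinate by coordinate, with no concentration of Lipschitz functions needed.
\<close>

context prob_space
begin

section \<open>Closure properties of scalar subgaussian variables\<close>

lemma subgaussian_dominated:
  assumes "subgaussian M \<phi>" "\<psi> \<in> borel_measurable M"
    and "\<And>\<omega>. \<omega> \<in> space M \<Longrightarrow> \<bar>\<psi> \<omega>\<bar> \<le> \<bar>\<phi> \<omega>\<bar>"
  shows "subgaussian M \<psi>"
proof -
  from assms(1) have [measurable]: "\<phi> \<in> borel_measurable M"
    by (simp add: subgaussian_def)
  note [measurable] = assms(2)
  have le: "prob {\<omega> \<in> space M. \<bar>\<psi> \<omega>\<bar> > t} \<le> prob {\<omega> \<in> space M. \<bar>\<phi> \<omega>\<bar> > t}" for t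
    by (rule finite_measure_mono) (use assms(3) in \<open>force+\<close>)
  show ?thesis
    using assms(1,2) unfolding subgaussian_def by (blast intro: order_trans[OF le])
qed

lemma subgaussian_const: "subgaussian M (\<lambda>_. c)"
  unfolding subgaussian_def
\<comment> \<open>For \<open>t < \<bar>c\<bar>\<close> the bound is at least 1, and for larger
  \<open>t\<close> the event is empty. The summand 1 keeps the witness positive when
  \<open>c = 0\<close>.\<close>
proof (intro conjI exI[of _ "\<bar>c\<bar> + 1"] allI impI)
  fix t :: real assume t: "t \<ge> 0"
  show "prob {\<omega> \<in> space M. \<bar>c\<bar> > t} \<le> exp (1 - t\<^sup>2 / (\<bar>c\<bar> + 1)\<^sup>2)"
  proof (cases "t < \<bar>c\<bar>")
    case True
    then have "t\<^sup>2 \<le> (\<bar>c\<bar> + 1)\<^sup>2"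
      using t by (intro power_mono) auto
    then have "t\<^sup>2 / (\<bar>c\<bar> + 1)\<^sup>2 \<le> 1"
      by (intro divide_le_eq_1[THEN iffD2]) auto
    then have "1 \<le> exp (1 - t\<^sup>2 / (\<bar>c\<bar> + 1)\<^sup>2)"
      by simp
    then show ?thesis
      using prob_le_1 order_trans by blast
  qed auto
qed auto

lemma subgaussian_cmult:
  assumes "subgaussian M \<phi>"
  shows "subgaussian M (\<lambda>\<omega>. a * \<phi> \<omega>)"
\<comment> \<open>The witness \<open>\<bar>a\<bar> * \<kappa>\<close>, obtained by evaluating the
  tail of \<open>\<phi>\<close> at level \<open>t / \<bar>a\<bar>\<close>, is positive only for
  nonzero \<open>a\<close>.\<close>
proof (cases "a = 0")
  case True
  then show ?thesis
    using subgaussian_const[of 0] by simp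
next
  case False
  from assms obtain \<kappa> where m: "\<phi> \<in> borel_measurable M" and \<kappa>: "\<kappa> > 0"
    and le: "\<And>t. t \<ge> 0 \<Longrightarrow> prob {\<omega> \<in> space M. \<bar>\<phi> \<omega>\<bar> > t} \<le> exp (1 - t\<^sup>2 / \<kappa>\<^sup>2)"
    unfolding subgaussian_def by blast
  show ?thesis
    unfolding subgaussian_def
  proof (intro conjI exI[of _ "\<bar>a\<bar> * \<kappa>"] allI impI)
    fix t :: real assume "t \<ge> 0"
    then show "prob {\<omega> \<in> space M. \<bar>a * \<phi> \<omega>\<bar> > t} \<le> exp (1 - t\<^sup>2 / (\<bar>a\<bar> * \<kappa>)\<^sup>2)"
      using le[of "t / \<bar>a\<bar>"] False
      by (simp add: abs_mult pos_divide_less_eq power_divide power_mult_distrib mult.commute)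
  qed (use m \<kappa> False in auto)
qed

text \<open>If the sum exceeds \<open>t\<close> in absolute value, one summand exceeds
  \<open>t / 2\<close>. The union bound then works for dependent summands, such as the coordinates
  of a layer's output.\<close>

lemma subgaussian_add:
  assumes "subgaussian M \<phi>" "subgaussian M \<psi>"
  shows "subgaussian M (\<lambda>\<omega>. \<phi> \<omega> + \<psi> \<omega>)"
proof -
  from assms(1) obtain \<kappa>1 where m1 [measurable]: "\<phi> \<in> borel_measurable M" and \<kappa>1: "\<kappa>1 > 0"
    and le1: "\<And>t. t \<ge> 0 \<Longrightarrow> prob {\<omega> \<in> space M. \<bar>\<phi> \<omega>\<bar> > t} \<le> exp (1 - t\<^sup>2 / \<kappa>1\<^sup>2)"
    unfolding subgaussian_def by blast
  from assms(2) obtain \<kappa>2 where m2 [measurable]: "\<psi> \<in> borel_measurable M" and \<kappa>2: "\<kappa>2 > 0"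
    and le2: "\<And>t. t \<ge> 0 \<Longrightarrow> prob {\<omega> \<in> space M. \<bar>\<psi> \<omega>\<bar> > t} \<le> exp (1 - t\<^sup>2 / \<kappa>2\<^sup>2)"
    unfolding subgaussian_def by blast
  \<comment> \<open>The tail bound weakens as its constant grows, so the larger constant serves both
    summands.\<close>
  define \<kappa> where "\<kappa> = max \<kappa>1 \<kappa>2"
  have \<kappa>: "\<kappa> > 0"
    using \<kappa>1 by (simp add: \<kappa>_def)
  have mono: "exp (1 - t\<^sup>2 / k\<^sup>2) \<le> exp (1 - t\<^sup>2 / \<kappa>\<^sup>2)" if "0 < k" "k \<le> \<kappa>" for k t :: real
    using that by (simp add: divide_left_mono power_mono)
  show ?thesis
    unfolding subgaussian_def
  \<comment> \<open>One factor 2 of the witness pays for halving the level. The other divides the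
    exponent \<open>s\<close> by 4, which leaves room to absorb the factor 2 of the union
    bound.\<close>
  proof (intro conjI exI[of _ "4 * \<kappa>"] allI impI)
    fix t :: real assume t: "t \<ge> 0"
    define s where "s = (t / 2)\<^sup>2 / \<kappa>\<^sup>2"
    have s4: "t\<^sup>2 / (4 * \<kappa>)\<^sup>2 = s / 4"
      by (simp add: s_def power_divide power_mult_distrib)
    have "prob {\<omega> \<in> space M. \<bar>\<phi> \<omega> + \<psi> \<omega>\<bar> > t} \<le> exp (1 - s / 4)"
    \<comment> \<open>For small \<open>s\<close> the target is at least 1. For \<open>s > 4\<close>,
      the estimates \<open>2 \<le> exp 1\<close> and \<open>2 - s \<le> 1 - s / 4\<close> finish the
      bound.\<close>
    proof (cases "s \<le> 4")
      case True
      then have "1 \<le> exp (1 - s / 4)"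
        by simp
      then show ?thesis
        using prob_le_1 order_trans by blast
    next
      case False
      have "prob {\<omega> \<in> space M. \<bar>\<phi> \<omega> + \<psi> \<omega>\<bar> > t} \<le>
          prob ({\<omega> \<in> space M. \<bar>\<phi> \<omega>\<bar> > t / 2} \<union> {\<omega> \<in> space M. \<bar>\<psi> \<omega>\<bar> > t / 2})"
        by (rule finite_measure_mono) auto
      also have "\<dots> \<le> prob {\<omega> \<in> space M. \<bar>\<phi> \<omega>\<bar> > t / 2} + prob {\<omega> \<in> space M. \<bar>\<psi> \<omega>\<bar> > t / 2}"
        by (rule measure_Un_le) auto
      also have "\<dots> \<le> exp (1 - s) + exp (1 - s)"
        unfolding s_def using t \<kappa>1 \<kappa>2
        by (intro add_mono order_trans[OF le1 mono] order_trans[OF le2 mono])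
           (auto simp: \<kappa>_def)
      also have "\<dots> \<le> exp 1 * exp (1 - s)"
        using exp_ge_add_one_self[of 1] mult_right_mono[of 2 "exp 1" "exp (1 - s)"] by simp
      also have "\<dots> \<le> exp (1 - s / 4)"
        using False by (simp flip: exp_add)
      finally show ?thesis .
    qed
    then show "prob {\<omega> \<in> space M. \<bar>\<phi> \<omega> + \<psi> \<omega>\<bar> > t} \<le> exp (1 - t\<^sup>2 / (4 * \<kappa>)\<^sup>2)"
      by (simp only: s4)
  qed (use \<kappa> in auto)
qed

lemma subgaussian_sum:
  assumes "\<And>i. i \<in> I \<Longrightarrow> subgaussian M (\<phi> i)"
  shows "subgaussian M (\<lambda>\<omega>. \<Sum>i\<in>I. \<phi> i \<omega>)"
  using assms
  \<comment> \<open>Over an infinite \<open>I\<close> the sum is 0 by convention, so the constant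
    case covers it together with the empty sum.\<close>
  by (induction I rule: infinite_finite_induct) (auto intro: subgaussian_const subgaussian_add)

section \<open>Gaussian variables and the reduction of vectors to coordinates\<close>

lemma subgaussian_std_normal:
  assumes [measurable]: "\<phi> \<in> borel_measurable M"
    and distr: "distr M borel \<phi> = density lborel std_normal_density"
  shows "subgaussian M \<phi>"
  unfolding subgaussian_def
proof (intro conjI exI[of _ 2] allI impI)
  fix t :: real assume t: "t \<ge> 0"
  \<comment> \<open>Chernoff's bound with \<open>exp (x\<^sup>2 / 4)\<close>, whose product with the density of N(0,1) is a multiple of that of N(0,2)\<close>
  have pointwise: "std_normal_density x * indicator {x. \<bar>x\<bar> > t} x \<le>
      exp (1 - t\<^sup>2 / 2\<^sup>2) * normal_density 0 (sqrt 2) x" for x :: real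
  proof (cases "\<bar>x\<bar> > t")
    case True
    \<comment> \<open>The ratio of the normalising constants of N(0,2) and N(0,1) is
      \<open>sqrt 2\<close>; the factor \<open>exp 1\<close> in the tail bound absorbs it.\<close>
    have "sqrt 2 \<le> exp 1"
      using real_sqrt_le_mono[of 2 4] exp_ge_add_one_self[of 1] by simp
    \<comment> \<open>Half of the exponent is bounded through \<open>\<bar>x\<bar> > t\<close>,
      which is where the constant 2 comes from; the other half remains as the shape of the N(0,2)
      density.\<close>
    moreover have "exp (- x\<^sup>2 / 2) \<le> exp (- t\<^sup>2 / 4) * exp (- x\<^sup>2 / 4)"
      using True t power_mono[of t "\<bar>x\<bar>" 2] by (simp flip: exp_add)
    ultimately have "sqrt 2 * exp (- x\<^sup>2 / 2) \<le> exp 1 * (exp (- t\<^sup>2 / 4) * exp (- x\<^sup>2 / 4))"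
      by (intro mult_mono) auto
    then have "exp (- x\<^sup>2 / 2) \<le> exp (1 - t\<^sup>2 / 4) * (exp (- x\<^sup>2 / 4) / sqrt 2)"
      using exp_add[of 1 "- t\<^sup>2 / 4"] by (simp add: pos_le_divide_eq mult_ac)
    then have "exp (- x\<^sup>2 / 2) / sqrt (2 * pi) \<le>
        exp (1 - t\<^sup>2 / 4) * (exp (- x\<^sup>2 / 4) / sqrt 2) / sqrt (2 * pi)"
      by (rule divide_right_mono) simp
    then show ?thesis
      using True by (simp add: normal_density_def std_normal_density_def real_sqrt_mult mult_ac)
  qed simp
  have "emeasure M {\<omega> \<in> space M. \<bar>\<phi> \<omega>\<bar> > t} = emeasure (distr M borel \<phi>) {x. \<bar>x\<bar> > t}"
    by (subst emeasure_distr) (auto intro!: arg_cong[where f = "emeasure M"])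
  also have "\<dots> = (\<integral>\<^sup>+x. ennreal (std_normal_density x * indicator {x. \<bar>x\<bar> > t} x) \<partial>lborel)"
    unfolding distr by (subst emeasure_density) (auto simp: ennreal_mult ennreal_indicator)
  also have "\<dots> \<le> (\<integral>\<^sup>+x. ennreal (exp (1 - t\<^sup>2 / 2\<^sup>2)) * ennreal (normal_density 0 (sqrt 2) x) \<partial>lborel)"
    using pointwise by (intro nn_integral_mono) (simp add: ennreal_leI flip: ennreal_mult)
  also have "\<dots> = ennreal (exp (1 - t\<^sup>2 / 2\<^sup>2)) * emeasure (density lborel (normal_density 0 (sqrt 2))) UNIV"
    by (simp add: nn_integral_cmult emeasure_density)
  also have "\<dots> = ennreal (exp (1 - t\<^sup>2 / 2\<^sup>2))"
    using prob_space.emeasure_space_1[OF prob_space_normal_density[of "sqrt 2" 0]] by simp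
  finally show "prob {\<omega> \<in> space M. \<bar>\<phi> \<omega>\<bar> > t} \<le> exp (1 - t\<^sup>2 / 2\<^sup>2)"
    by (simp add: emeasure_eq_measure)
qed auto

text \<open>Every marginal is a finite linear combination of coordinates, so closure under scaling
  and sums suffices.\<close>

lemma subgaussian_vecI:
  assumes "\<phi> \<in> measurable M (borel_vec n)"
    and "\<And>i. i < n \<Longrightarrow> subgaussian M (\<lambda>\<omega>. \<phi> \<omega> i)"
  shows "subgaussian_vec M n \<phi>"
  unfolding subgaussian_vec_def
  using assms by (auto intro!: subgaussian_sum subgaussian_cmult)

text \<open>By the product form \<open>std_normal_vec_eq_PiM\<close>, each coordinate is a
  one-dimensional standard normal.\<close>

lemma subgaussian_vec_std_normal:
  assumes m: "\<phi> \<in> measurable M (borel_vec n)"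
    and distr: "distr M (borel_vec n) \<phi> = std_normal_vec n"
  shows "subgaussian_vec M n \<phi>"
proof (rule subgaussian_vecI[OF m])
  fix i assume i: "i < n"
  note [measurable] = m
  have comp: "(\<lambda>x. x i) \<in> borel_measurable (borel_vec n)"
    using i by simp
  have "distr M borel (\<lambda>\<omega>. \<phi> \<omega> i) = distr (std_normal_vec n) borel (\<lambda>x. x i)"
    unfolding distr[symmetric] by (simp add: distr_distr[OF comp m] o_def)
  \<comment> \<open>A push-forward depends on its target only through the sigma-algebra; replacing
    \<open>borel\<close> by the factor measure gives the form of
    \<open>distr_PiM_component\<close>.\<close>
  also have "\<dots> = distr (std_normal_vec n) (density lborel std_normal_density) (\<lambda>x. x i)"
    by (rule distr_cong) auto
  also have "\<dots> = density lborel std_normal_density"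
    unfolding std_normal_vec_eq_PiM using i
    by (intro distr_PiM_component prob_space_normal_density) auto
  finally show "subgaussian M (\<lambda>\<omega>. \<phi> \<omega> i)"
    using measurable_compose[OF m comp] by (intro subgaussian_std_normal)
qed

end

section \<open>Passing through one layer\<close>

lemma relu_measurable [measurable]: "relu \<in> borel_measurable borel"
  unfolding relu_def [abs_def] by measurable

lemma layer_measurable [measurable]: "layer m n W b \<in> measurable (borel_vec m) (borel_vec n)"
  unfolding layer_def [abs_def] by (rule measurable_restrict) measurable

text \<open>Before the ReLU, output coordinate \<open>j\<close> is the marginal of the input along
  column \<open>j\<close> of \<open>W\<close>, plus a constant. The ReLU only decreases absolute
  values, so domination applies.\<close>

lemma (in prob_space) subgaussian_vec_layer:
  assumes "subgaussian_vec M m \<phi>"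
  shows "subgaussian_vec M n (\<lambda>\<omega>. layer m n W b (\<phi> \<omega>))"
proof (rule subgaussian_vecI)
  from assms have m: "\<phi> \<in> measurable M (borel_vec m)"
    and sg: "\<And>\<alpha>. subgaussian M (\<lambda>\<omega>. \<Sum>i<m. \<alpha> i * \<phi> \<omega> i)"
    by (auto simp: subgaussian_vec_def)
  show "(\<lambda>\<omega>. layer m n W b (\<phi> \<omega>)) \<in> measurable M (borel_vec n)"
    using m by measurable
  fix j assume j: "j < n"
  have "subgaussian M (\<lambda>\<omega>. (\<Sum>i<m. W i j * \<phi> \<omega> i) + b j)"
    by (intro subgaussian_add sg subgaussian_const)
  then have "subgaussian M (\<lambda>\<omega>. relu ((\<Sum>i<m. W i j * \<phi> \<omega> i) + b j))"
    by (rule subgaussian_dominated)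
       (use \<open>subgaussian M (\<lambda>\<omega>. (\<Sum>i<m. W i j * \<phi> \<omega> i) + b j)\<close> in
         \<open>auto simp: subgaussian_def relu_def\<close>)
  then show "subgaussian M (\<lambda>\<omega>. layer m n W b (\<phi> \<omega>) j)"
    using j by (simp add: layer_def)
qed

section \<open>Transfer of the i.i.d. property\<close>

text \<open>All indices share the map \<open>f\<close>, so every image law is the push-forward under
  \<open>f\<close> of one common law.\<close>

lemma iid_compose:
  assumes M: "prob_space M" and iid: "iid M S X I" and f: "f \<in> measurable S T"
  shows "iid M T (\<lambda>p \<omega>. f (X p \<omega>)) I"
proof -
  interpret prob_space M by (rule M)
  have ind: "indep_vars (\<lambda>_. S) X I"
    and eq: "\<And>p q. p \<in> I \<Longrightarrow> q \<in> I \<Longrightarrow> distr M S (X p) = distr M S (X q)"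
    using iid unfolding iid_def by blast+
  have "distr M T (\<lambda>\<omega>. f (X p \<omega>)) = distr (distr M S (X p)) T f" if "p \<in> I" for p
  proof -
    have "X p \<in> measurable M S"
      using ind that by (simp add: indep_vars_def)
    then show ?thesis
      by (simp add: distr_distr[OF f] o_def)
  qed
  then show ?thesis
    unfolding iid_def using indep_vars_compose2[OF ind f] eq by metis
qed

text \<open>The network equation determines the responses only on \<open>space M\<close> and only
  for valid sample indices, so they need not equal the composed maps as functions. Both independence
  and laws depend on these values alone.\<close>

lemma iid_cong:
  assumes M: "prob_space M"
    and eq: "\<And>p \<omega>. p \<in> I \<Longrightarrow> \<omega> \<in> space M \<Longrightarrow> X p \<omega> = Y p \<omega>"
  shows "iid M S X I \<longleftrightarrow> iid M S Y I"
proof -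
  interpret prob_space M by (rule M)
  have "distr M S (X p) = distr M S (Y p)" if "p \<in> I" for p
    using eq that by (intro distr_cong) auto
  moreover have "X p -` A \<inter> space M = Y p -` A \<inter> space M" if "p \<in> I" for p A
    using eq that by auto
  then have "indep_vars (\<lambda>_. S) X I = indep_vars (\<lambda>_. S) Y I"
    unfolding indep_vars_def2 using eq
    by (intro conj_cong ball_cong measurable_cong indep_sets_cong) auto
  ultimately show ?thesis
    unfolding iid_def by auto
qed

lemma subgaussian_vec_cong:
  assumes "\<And>\<omega>. \<omega> \<in> space M \<Longrightarrow> \<phi> \<omega> = \<psi> \<omega>"
  shows "subgaussian_vec M n \<phi> \<longleftrightarrow> subgaussian_vec M n \<psi>"
  using assms
  by (simp add: subgaussian_vec_def subgaussian_def cong: measurable_cong conj_cong)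

theorem theorem3:
  fixes M :: "'a measure"
    and L P :: nat
    and N :: "nat \<Rightarrow> nat"
    and W :: "nat \<Rightarrow> nat \<Rightarrow> nat \<Rightarrow> real"
    and b :: "nat \<Rightarrow> nat \<Rightarrow> real"
    and X :: "nat \<Rightarrow> nat \<Rightarrow> 'a \<Rightarrow> nat \<Rightarrow> real"
  assumes "prob_space M"
    and "iid M (borel_vec (N 0)) (X 0) {1..P}"
    and "\<And>p. p \<in> {1..P} \<Longrightarrow> distr M (borel_vec (N 0)) (X 0 p) = std_normal_vec (N 0)"
    and "\<And>l p \<omega>. l \<in> {1..L} \<Longrightarrow> p \<in> {1..P} \<Longrightarrow> \<omega> \<in> space M \<Longrightarrow>
           X l p \<omega> = layer (N (l - 1)) (N l) (W l) (b l) (X (l - 1) p \<omega>)"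
  shows "\<forall>l\<in>{1..L}. iid M (borel_vec (N l)) (X l) {1..P} \<and>
           (\<forall>p\<in>{1..P}. subgaussian_vec M (N l) (X l p))"
proof -
  interpret prob_space M by (rule assms(1))
  \<comment> \<open>The claim is extended to \<open>l = 0\<close>, so that the induction starts at
    the Gaussian input.\<close>
  have *: "iid M (borel_vec (N l)) (X l) {1..P} \<and> (\<forall>p\<in>{1..P}. subgaussian_vec M (N l) (X l p))"
    if "l \<le> L" for l
    using that
  proof (induction l)
    case 0
    have "X 0 p \<in> measurable M (borel_vec (N 0))" if "p \<in> {1..P}" for p
      using assms(2) that by (auto simp: iid_def indep_vars_def)
    then show ?case
      using assms(2,3) by (blast intro: subgaussian_vec_std_normal)
  next
    case (Suc l)
    let ?f = "layer (N l) (N (Suc l)) (W (Suc l)) (b (Suc l))"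
    \<comment> \<open>Indexing by \<open>Suc l\<close> turns the predecessor in the network equation
      into \<open>l\<close>, the layer of the induction hypothesis.\<close>
    have X: "X (Suc l) p \<omega> = ?f (X l p \<omega>)" if "p \<in> {1..P}" "\<omega> \<in> space M" for p \<omega>
      using assms(4)[of "Suc l" p \<omega>] Suc.prems that by simp
    have "iid M (borel_vec (N (Suc l))) (X (Suc l)) {1..P} \<longleftrightarrow>
        iid M (borel_vec (N (Suc l))) (\<lambda>p \<omega>. ?f (X l p \<omega>)) {1..P}"
      by (rule iid_cong[OF assms(1) X])
    moreover have "iid M (borel_vec (N (Suc l))) (\<lambda>p \<omega>. ?f (X l p \<omega>)) {1..P}"
      using Suc by (intro iid_compose[OF assms(1) _ layer_measurable]) auto
    moreover have "subgaussian_vec M (N (Suc l)) (X (Suc l) p)" if "p \<in> {1..P}" for p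
      using Suc that by (subst subgaussian_vec_cong[OF X]) (auto intro: subgaussian_vec_layer)
    ultimately show ?case
      by blast
  qed
  then show ?thesis
    by simp
qed

end
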